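(* Let $H$ be a Heyting algebra and let $M$ be a Heyting module over $H$. Let $\mathbf c:Sub(M)\to Sub(M)$ be a closure operator of finite type. Then the collection $Sub^{\mathbf c}(M)$ of Heyting submodules of $M$ fixed by $\mathbf c$, with the subspace topology induced from $Sub(M)$, is a spectral space having the collection $\mathcal S^{\mathbf c}$ of subsets of the form $D(m_1,\dots,m_n)\cap Sub^{\mathbf c}(M)$ as a subbasis of quasi-compact open sets.
   Context: Lattices have all finite meets and joins (hence a least element $0$ and a greatest element $1$). A join semilattice is a poset in which every finite subset, including the empty one, has a join; its least element is $0$. For a distributive lattice $L$, a distributive module over $L$ is a join semilattice $M$ with an action $L\times M\to M$, $(x,m)\mapsto x\wedge m$, order preserving in both variables, such that $1\wedge m=m$, $0\wedge m=0$, $(x\wedge y)\wedge m=x\wedge(y\wedge m)$, $(x\vee y)\wedge m=(x\wedge m)\vee(y\wedge m)$, $x\wedge(m\vee n)=(x\wedge m)\vee(x\wedge n)$. A Heyting algebra $H$ (not assumed finite here) is a lattice such that for all $y,z\in H$ there is $(y\to z)_H\in H$ with $x\wedge y\le z\Leftrightarrow x\le (y\to z)_H$ for all $x\in H$. A Heyting module over $H$ is a distributive module $M$ over $H$ such that for all $m,n\in M$ there is $(m\to n)_M\in H$ with $x\wedge m\le n\Leftrightarrow x\le(m\to n)_M$ for all $x\in H$. A Heyting submodule of $M$ is a subset closed under finite joins (so containing $0$) and under the action of $H$; $Sub(M)$ is the set of Heyting submodules of $M$. For a finite collection $m_1,\dots,m_n$ of elements of $M$ set $V(m_1,\dots,m_n)=\{N\in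 Sub(M) : m_1,\dots,m_n\in N\}$ and $D(m_1,\dots,m_n)=Sub(M)\setminus V(m_1,\dots,m_n)$. $Sub(M)$ carries the topology with the sets $V(m_1,\dots,m_n)$ as a subbasis of closed sets. A Heyting submodule is finitely generated if it is the smallest Heyting submodule containing some finite set of elements; $fg(N)$ is the collection of finitely generated Heyting submodules of $N$. A closure operator on Heyting submodules of $M$ is a map $\mathbf c:Sub(M)\to Sub(M)$ that is extensive ($N\subseteq\mathbf c(N)$), order preserving ($N\subseteq N'$ implies $\mathbf c(N)\subseteq\mathbf c(N')$) and idempotent ($\mathbf c(\mathbf c(N))=\mathbf c(N)$). It is of finite type if $\mathbf c(N)=\bigcup_{N'\in fg(N)}\mathbf c(N')$ for every $N\in Sub(M)$. A topological space is spectral if it is homeomorphic to the Zariski spectrum of a commutative ring; equivalently (Hochster) it is quasi-compact, its quasi-compact open subsets are closed under (finite) intersection and form a basis, and every non-empty irreducible closed subset has a unique generic point. *)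

theory Defs
  imports "HOL-Analysis.Analysis"
begin

section \<open>Heyting algebras and Heyting modules\<close>

class heyting_algebra = bounded_lattice +
  assumes ex_heyting_imp: "\<exists>w. \<forall>x. inf x y \<le> z \<longleftrightarrow> x \<le> w"
begin

subclass distrib_lattice
proof
  have le: "inf x (sup y z) \<le> sup (inf x y) (inf x z)" for x y z
  proof -
    obtain w where w: "\<And>a. inf a x \<le> sup (inf x y) (inf x z) \<longleftrightarrow> a \<le> w"
      using ex_heyting_imp by metis
    have "y \<le> w" "z \<le> w"
      by (simp_all add: w [symmetric] inf_commute)
    then have "sup y z \<le> w"
      by simp
    then show ?thesis
      by (simp add: w [symmetric] inf_commute)
  qed
  have "inf x (sup y z) = sup (inf x y) (inf x z)" for x y z
    by (rule order.antisym [OF le distrib_inf_le])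
  then show "sup x (inf y z) = inf (sup x y) (sup x z)" for x y z
    by (rule distrib_imp1)
qed

end

text \<open>
  The module and the lattice acting on it are types; since all of the results are
  polymorphic in them, this is no restriction.
\<close>

locale distributive_module =
  fixes act :: "'l::{bounded_lattice,distrib_lattice}
                  \<Rightarrow> 'm::bounded_semilattice_sup_bot \<Rightarrow> 'm"  (infixr \<open>\<cdot>\<close> 75)
  assumes act_mono_left: "x \<le> y \<Longrightarrow> x \<cdot> m \<le> y \<cdot> m"
    and act_mono_right: "m \<le> n \<Longrightarrow> x \<cdot> m \<le> x \<cdot> n"
    and top_act: "top \<cdot> m = m"
    and bot_act: "bot \<cdot> m = bot"
    and inf_act: "inf x y \<cdot> m = x \<cdot> (y \<cdot> m)"
    and sup_act: "sup x y \<cdot> m = sup (x \<cdot> m) (y \<cdot> m)"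
    and act_sup: "x \<cdot> sup m n = sup (x \<cdot> m) (x \<cdot> n)"

locale heyting_module = distributive_module act
  for act :: "'h::heyting_algebra \<Rightarrow> 'm::bounded_semilattice_sup_bot \<Rightarrow> 'm"
    (infixr \<open>\<cdot>\<close> 75) +
  assumes ex_module_imp: "\<exists>w. \<forall>x. x \<cdot> m \<le> n \<longleftrightarrow> x \<le> w"

definition Sub :: "('h \<Rightarrow> 'm::bounded_semilattice_sup_bot \<Rightarrow> 'm) \<Rightarrow> 'm set set" where
  "Sub act = {N. bot \<in> N \<and> (\<forall>m\<in>N. \<forall>n\<in>N. sup m n \<in> N) \<and> (\<forall>x. \<forall>m\<in>N. act x m \<in> N)}"

definition finitely_generated ::
    "('h \<Rightarrow> 'm::bounded_semilattice_sup_bot \<Rightarrow> 'm) \<Rightarrow> 'm set \<Rightarrow> bool" where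
  "finitely_generated act N \<longleftrightarrow> N \<in> Sub act \<and>
     (\<exists>F. finite F \<and> F \<subseteq> N \<and> (\<forall>N'\<in>Sub act. F \<subseteq> N' \<longrightarrow> N \<subseteq> N'))"

definition fg :: "('h \<Rightarrow> 'm::bounded_semilattice_sup_bot \<Rightarrow> 'm) \<Rightarrow> 'm set \<Rightarrow> 'm set set" where
  "fg act N = {N'. finitely_generated act N' \<and> N' \<subseteq> N}"


section \<open>Closure operators on submodules\<close>

text \<open>
  A closure operator is represented by a function on all subsets of the module; only
  its values on submodules matter.
\<close>

definition closure_operator ::
    "('h \<Rightarrow> 'm::bounded_semilattice_sup_bot \<Rightarrow> 'm) \<Rightarrow> ('m set \<Rightarrow> 'm set) \<Rightarrow> bool" where
  "closure_operator act c \<longleftrightarrow>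
     (\<forall>N\<in>Sub act. c N \<in> Sub act) \<and>
     (\<forall>N\<in>Sub act. N \<subseteq> c N) \<and>
     (\<forall>N\<in>Sub act. \<forall>N'\<in>Sub act. N \<subseteq> N' \<longrightarrow> c N \<subseteq> c N') \<and>
     (\<forall>N\<in>Sub act. c (c N) = c N)"

definition finite_type ::
    "('h \<Rightarrow> 'm::bounded_semilattice_sup_bot \<Rightarrow> 'm) \<Rightarrow> ('m set \<Rightarrow> 'm set) \<Rightarrow> bool" where
  "finite_type act c \<longleftrightarrow> (\<forall>N\<in>Sub act. c N = (\<Union>N'\<in>fg act N. c N'))"

definition Sub_fixed ::
    "('h \<Rightarrow> 'm::bounded_semilattice_sup_bot \<Rightarrow> 'm) \<Rightarrow> ('m set \<Rightarrow> 'm set) \<Rightarrow> 'm set set" where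
  "Sub_fixed act c = {N \<in> Sub act. c N = N}"


section \<open>The topology on the set of submodules\<close>

definition V_set ::
    "('h \<Rightarrow> 'm::bounded_semilattice_sup_bot \<Rightarrow> 'm) \<Rightarrow> 'm set \<Rightarrow> 'm set set" where
  "V_set act F = {N \<in> Sub act. F \<subseteq> N}"

definition D_set ::
    "('h \<Rightarrow> 'm::bounded_semilattice_sup_bot \<Rightarrow> 'm) \<Rightarrow> 'm set \<Rightarrow> 'm set set" where
  "D_set act F = Sub act - V_set act F"

text \<open>
  The sets \<open>V_set act F\<close> with \<open>F\<close> finite form a subbasis of closed sets, i.e. their
  complements \<open>D_set act F\<close> form a subbasis of open sets.  The whole of \<open>Sub act\<close> is
  open as the empty intersection; it is not a union of sets \<open>D_set act F\<close>, since none
  of these contains the submodule \<open>UNIV\<close>, so \<open>topology_generated_by\<close> would yield too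
  small a space.
\<close>

definition Sub_topology ::
    "('h \<Rightarrow> 'm::bounded_semilattice_sup_bot \<Rightarrow> 'm) \<Rightarrow> 'm set topology" where
  "Sub_topology act =
     topology (arbitrary union_of
       (finite intersection_of (\<lambda>U. \<exists>F. finite F \<and> U = D_set act F) relative_to Sub act))"

definition S_fixed ::
    "('h \<Rightarrow> 'm::bounded_semilattice_sup_bot \<Rightarrow> 'm) \<Rightarrow> ('m set \<Rightarrow> 'm set) \<Rightarrow> 'm set set set" where
  "S_fixed act c = {D_set act F \<inter> Sub_fixed act c | F. finite F}"


section \<open>Subbases and spectral spaces\<close>

definition subbasis_of :: "'a topology \<Rightarrow> 'a set set \<Rightarrow> bool" where
  "subbasis_of X \<S> \<longleftrightarrow>
     openin X = arbitrary union_of (finite intersection_of (\<lambda>U. U \<in> \<S>) relative_to topspace X)"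

definition irreducible_in :: "'a topology \<Rightarrow> 'a set \<Rightarrow> bool" where
  "irreducible_in X Z \<longleftrightarrow> Z \<subseteq> topspace X \<and> Z \<noteq> {} \<and>
     (\<forall>A B. closedin X A \<and> closedin X B \<and> Z \<subseteq> A \<union> B \<longrightarrow> Z \<subseteq> A \<or> Z \<subseteq> B)"

text \<open>
  Spectral spaces in the intrinsic form due to Hochster.  (The description as the spaces
  homeomorphic to the Zariski spectrum of some commutative ring quantifies existentially
  over the carrier type of the ring, which cannot be done in HOL.)
\<close>

definition spectral_space :: "'a topology \<Rightarrow> bool" where
  "spectral_space X \<longleftrightarrow>
     compact_space X \<and>
     (\<forall>U V. openin X U \<and> compactin X U \<and> openin X V \<and> compactin X V \<longrightarrow> compactin X (U \<inter> V)) \<and>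
     openin X = arbitrary union_of (\<lambda>U. openin X U \<and> compactin X U) \<and>
     (\<forall>Z. closedin X Z \<and> irreducible_in X Z \<longrightarrow> (\<exists>!x. x \<in> topspace X \<and> X closure_of {x} = Z))"

end

theory Submission
  imports Defs
begin

text \<open>
  The \<open>c\<close>-fixed submodules form an algebraic closure system \<open>\<F>\<close> on the module, and only
  this matters.  Let \<open>P\<close> be a finite intersection of sets \<open>D(F)\<close>, covered by sets \<open>D(F')\<close>.
  Let \<open>S\<close> be the union of these \<open>F'\<close>.  The member of \<open>\<F>\<close> generated by \<open>S\<close> lies in no \<open>D(F')\<close>,
  hence not in \<open>P\<close>, so it contains one of the finite sets \<open>F\<close> defining \<open>P\<close>.  That is already
  forced by finitely many elements of \<open>S\<close>, hence by finitely many of the \<open>F'\<close>, and Alexander's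
  subbase theorem makes \<open>P\<close> compact.  The closure of a point \<open>N\<close> consists of the members of
  \<open>\<F>\<close> above \<open>N\<close>; an irreducible closed set has its intersection as generic point.
\<close>

section \<open>Subbases and compact open sets in general\<close>

lemma finite_intersection_of_relative_to_cong:
  assumes "P relative_to S = Q relative_to S"
  shows "finite intersection_of P relative_to S = finite intersection_of Q relative_to S"
  by (subst (1 2) finite_intersection_of_relative_to) (simp only: assms)

text \<open>\<open>UNIV\<close> is the empty intersection. Alexander's theorem asks for a subbase
  covering the space, which the complements used below need not do: the point \<open>UNIV\<close>
  lies in none of them.\<close>

lemma finite_intersection_of_insert_UNIV:
  "finite intersection_of (\<lambda>U. U \<in> insert UNIV \<S>) = finite intersection_of (\<lambda>U. U \<in> \<S>)"
proof (intro ext iffI)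
  fix T
  assume "(finite intersection_of (\<lambda>U. U \<in> insert UNIV \<S>)) T"
  then obtain \<U> where "finite \<U>" "\<U> \<subseteq> insert UNIV \<S>" "\<Inter>\<U> = T"
    by (auto simp: intersection_of_def)
  then show "(finite intersection_of (\<lambda>U. U \<in> \<S>)) T"
    unfolding intersection_of_def by (intro exI [of _ "\<U> - {UNIV}"]) auto
qed (auto elim: intersection_of_mono)

lemma compact_open_finite_union_of_basis:
  assumes "openin X = arbitrary union_of \<B>" and "compactin X U" "openin X U"
  shows "(finite union_of \<B>) U"
proof -
  obtain \<U> where \<U>: "\<U> \<subseteq> Collect \<B>" "\<Union>\<U> = U"
    using assms by (auto simp: union_of_def)
  have "openin X T" if "T \<in> \<U>" for T
    using that \<U>(1) assms(1) arbitrary_union_of_inc [of \<B> T] by auto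
  then have "\<exists>\<V>. finite \<V> \<and> \<V> \<subseteq> \<U> \<and> U \<subseteq> \<Union>\<V>"
    using \<U>(2) by (intro compactinD [OF assms(2)]) auto
  then obtain \<V> where \<V>: "finite \<V>" "\<V> \<subseteq> \<U>" "U \<subseteq> \<Union>\<V>"
    by blast
  then have "\<Union>\<V> = U"
    using \<U>(2) Union_mono [OF \<V>(2)] by (simp add: subset_antisym)
  moreover have "\<V> \<subseteq> Collect \<B>"
    using \<V>(2) \<U>(1) by (rule order_trans)
  ultimately show ?thesis
    using \<V>(1) unfolding union_of_def by blast
qed


section \<open>Topologies on families of sets\<close>

text \<open>Equivalently, the trace on \<open>\<F>\<close> of the product of Sierpinski spaces in
  which each \<open>{N. m \<notin> N}\<close> is open. Complements are taken in the whole power set,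
  so the subbasis does not vary with \<open>\<F>\<close>.\<close>

definition lower_topology :: "'a set set \<Rightarrow> 'a set topology" where
  "lower_topology \<F> =
     topology (arbitrary union_of
       (finite intersection_of (\<lambda>U. U \<in> {- {N. F \<subseteq> N} | F. finite F}) relative_to \<F>))"

lemma topspace_lower_topology [simp]: "topspace (lower_topology \<F>) = \<F>"
  by (simp add: lower_topology_def)

lemma openin_lower_topology_subbase:
  "openin (lower_topology \<F>) = arbitrary union_of
     (finite intersection_of (\<lambda>U. U \<in> {- {N. F \<subseteq> N} | F. finite F}) relative_to \<F>)"
  by (intro ext) (simp only: lower_topology_def openin_subbase)

text \<open>As the subbasis is independent of the family, restricting twice is restricting to the
  intersection.\<close>

lemma subtopology_lower_topology:
  "subtopology (lower_topology \<F>) \<G> = lower_topology (\<F> \<inter> \<G>)"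
  unfolding topology_eq openin_subtopology lower_topology_def openin_subbase
  unfolding relative_to_relative_to [symmetric] arbitrary_union_of_relative_to [symmetric]
  by (auto simp: relative_to_def)

lemma compactin_lower_topology:
  "compactin (lower_topology \<F>) \<G> \<longleftrightarrow> \<G> \<subseteq> \<F> \<and> compact_space (lower_topology \<G>)"
  by (simp add: compactin_subspace subtopology_lower_topology inf.absorb2 cong: conj_cong)

text \<open>For a finite \<open>\<A>\<close> of finite sets this is the trace of a finite
  intersection of subbasic sets; \<open>\<A> = {}\<close> gives \<open>\<F>\<close> itself.\<close>

definition missing :: "'a set set \<Rightarrow> 'a set set \<Rightarrow> 'a set set" where
  "missing \<F> \<A> = {N \<in> \<F>. \<forall>F\<in>\<A>. \<not> F \<subseteq> N}"

lemma missing_Int: "missing \<F> \<A> \<inter> missing \<F> \<B> = missing \<F> (\<A> \<union> \<B>)"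
  by (auto simp: missing_def)

definition basic_lower_open :: "'a set set \<Rightarrow> 'a set set \<Rightarrow> bool" where
  "basic_lower_open \<F> T \<longleftrightarrow> (\<exists>\<A>. finite \<A> \<and> (\<forall>F\<in>\<A>. finite F) \<and> T = missing \<F> \<A>)"

lemma basic_lower_open_Int:
  assumes "basic_lower_open \<F> S" "basic_lower_open \<F> T"
  shows "basic_lower_open \<F> (S \<inter> T)"
proof -
  obtain \<A> \<B> where "finite \<A>" "\<forall>F\<in>\<A>. finite F" "S = missing \<F> \<A>"
    and "finite \<B>" "\<forall>F\<in>\<B>. finite F" "T = missing \<F> \<B>"
    using assms unfolding basic_lower_open_def by blast
  then show ?thesis
    unfolding basic_lower_open_def by (intro exI [of _ "\<A> \<union> \<B>"]) (auto simp: missing_Int)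
qed

lemma openin_lower_topology:
  "openin (lower_topology \<F>) = arbitrary union_of basic_lower_open \<F>"
proof -
  let ?S = "{- {N. F \<subseteq> N} | F. finite F}"
  have "(finite intersection_of (\<lambda>U. U \<in> ?S) relative_to \<F>) T \<longleftrightarrow> basic_lower_open \<F> T" for T
  proof
    assume "(finite intersection_of (\<lambda>U. U \<in> ?S) relative_to \<F>) T"
    then obtain \<U> where \<U>: "finite \<U>" "\<U> \<subseteq> ?S" "T = \<F> \<inter> \<Inter>\<U>"
      unfolding relative_to_def intersection_of_def Collect_mem_eq by blast
    \<comment> \<open>Seen as part of an image, the finite family \<open>\<U>\<close> can be indexed
      by a finite \<open>\<A>\<close>.\<close>
    have "\<U> \<subseteq> (\<lambda>F. - {N. F \<subseteq> N}) ` {F. finite F}"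
      using \<U>(2) by (simp only: setcompr_eq_image)
    then obtain \<A> where \<A>: "\<A> \<subseteq> {F. finite F}" "finite \<A>" "\<U> = (\<lambda>F. - {N. F \<subseteq> N}) ` \<A>"
      using finite_subset_image [OF \<U>(1)] by metis
    then have "T = missing \<F> \<A>"
      using \<U>(3) by (auto simp: missing_def)
    with \<A>(1,2) show "basic_lower_open \<F> T"
      unfolding basic_lower_open_def by blast
  next
    assume "basic_lower_open \<F> T"
    then obtain \<A> where \<A>: "finite \<A>" "\<forall>F\<in>\<A>. finite F" "T = missing \<F> \<A>"
      unfolding basic_lower_open_def by blast
    let ?U = "(\<lambda>F. - {N. F \<subseteq> N}) ` \<A>"
    have "?U \<subseteq> ?S"
      using \<A>(2) by blast
    then have "(finite intersection_of (\<lambda>U. U \<in> ?S)) (\<Inter>?U)"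
      unfolding intersection_of_def Collect_mem_eq using \<A>(1) by blast
    moreover have "\<F> \<inter> \<Inter>?U = T"
      using \<A>(3) by (auto simp: missing_def)
    ultimately show "(finite intersection_of (\<lambda>U. U \<in> ?S) relative_to \<F>) T"
      unfolding relative_to_def by blast
  qed
  then have "finite intersection_of (\<lambda>U. U \<in> ?S) relative_to \<F> = basic_lower_open \<F>"
    by blast
  then show ?thesis
    by (simp only: openin_lower_topology_subbase)
qed

lemma openin_lower_topologyE:
  assumes "openin (lower_topology \<F>) T" "N \<in> T"
  obtains \<A> where "finite \<A>" "\<forall>F\<in>\<A>. finite F" "N \<in> missing \<F> \<A>" "missing \<F> \<A> \<subseteq> T"
proof -
  obtain U where "basic_lower_open \<F> U" "N \<in> U" "U \<subseteq> T"
    using assms unfolding openin_lower_topology arbitrary_union_of_alt by blast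
  then show thesis
    using that unfolding basic_lower_open_def by blast
qed

lemma closedin_lower_topology_above:
  assumes "finite F"
  shows "closedin (lower_topology \<F>) {N \<in> \<F>. F \<subseteq> N}"
proof -
  have "basic_lower_open \<F> (missing \<F> {F})"
    using assms by (auto simp: basic_lower_open_def)
  then have "openin (lower_topology \<F>) (missing \<F> {F})"
    by (simp add: openin_lower_topology arbitrary_union_of_inc)
  moreover have "\<F> - {N \<in> \<F>. F \<subseteq> N} = missing \<F> {F}"
    by (auto simp: missing_def)
  ultimately show ?thesis
    by (auto simp: closedin_def)
qed

section \<open>Point closures and irreducible sets\<close>

text \<open>For each \<open>m \<in> N\<close> the members containing \<open>m\<close> form a closed
  set, which bounds the closure from above. Conversely, basic open sets are downward closed in
  \<open>\<F>\<close>, so every neighbourhood of a member above \<open>N\<close> contains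
  \<open>N\<close>.\<close>

lemma lower_topology_closure_of_singleton:
  assumes "N \<in> \<F>"
  shows "lower_topology \<F> closure_of {N} = {N' \<in> \<F>. N \<subseteq> N'}"
proof (intro equalityI subsetI)
  fix N'
  assume N': "N' \<in> lower_topology \<F> closure_of {N}"
  have "m \<in> N'" if "m \<in> N" for m
    using closure_of_minimal [OF _ closedin_lower_topology_above [of "{m}" \<F>], of "{N}"] N' that assms
    by auto
  moreover have "N' \<in> \<F>"
    using N' by (simp add: in_closure_of)
  ultimately show "N' \<in> {N' \<in> \<F>. N \<subseteq> N'}"
    by blast
next
  fix N'
  assume N': "N' \<in> {N' \<in> \<F>. N \<subseteq> N'}"
  have "N \<in> T" if "N' \<in> T" and T: "openin (lower_topology \<F>) T" for T
  proof -
    obtain \<A> where "N' \<in> missing \<F> \<A>" "missing \<F> \<A> \<subseteq> T"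
      using openin_lower_topologyE [OF T \<open>N' \<in> T\<close>] .
    moreover have "N \<in> missing \<F> \<A>"
      using N' calculation(1) assms by (auto simp: missing_def)
    ultimately show ?thesis
      by blast
  qed
  with N' show "N' \<in> lower_topology \<F> closure_of {N}"
    by (simp add: in_closure_of)
qed

lemma irreducible_in_finite_Union:
  assumes "irreducible_in X Z" "finite \<A>" "\<And>A. A \<in> \<A> \<Longrightarrow> closedin X A" "Z \<subseteq> \<Union>\<A>"
  shows "\<exists>A\<in>\<A>. Z \<subseteq> A"
  using assms(2-4)
proof (induction \<A>)
  case empty
  then show ?case
    using assms(1) by (auto simp: irreducible_in_def)
next
  case (insert A \<A>)
  have "closedin X (\<Union>\<A>)"
    using insert by (intro closedin_Union) auto
  then have "Z \<subseteq> A \<or> Z \<subseteq> \<Union>\<A>"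
    using assms(1) insert.prems unfolding irreducible_in_def by (simp add: insert_iff)
  then show ?case
    using insert by blast
qed


section \<open>Algebraic closure systems\<close>

text \<open>Taking \<open>\<G>\<close> empty puts \<open>UNIV\<close> in \<open>\<F>\<close>, so
  every set has a hull in \<open>\<F>\<close>. The condition \<open>finitary\<close> is the
  lattice-theoretic form of finite type.\<close>

locale algebraic_closure_system =
  fixes \<F> :: "'a set set"
  assumes Inter_closed: "\<G> \<subseteq> \<F> \<Longrightarrow> \<Inter>\<G> \<in> \<F>"
    and finitary: "m \<in> (\<lambda>N. N \<in> \<F>) hull S \<Longrightarrow>
          \<exists>S'\<subseteq>S. finite S' \<and> m \<in> (\<lambda>N. N \<in> \<F>) hull S'"
begin

abbreviation generated :: "'a set \<Rightarrow> 'a set" where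
  "generated S \<equiv> (\<lambda>N. N \<in> \<F>) hull S"

lemma generated_mem: "generated S \<in> \<F>"
  by (rule hull_in) (auto intro: Inter_closed)

text \<open>The union of finite supports of the single elements of \<open>F\<close> works, by
  monotonicity of the hull.\<close>

lemma finite_subset_generated:
  assumes "finite F" "F \<subseteq> generated S"
  shows "\<exists>S'\<subseteq>S. finite S' \<and> F \<subseteq> generated S'"
  using assms
proof (induction F)
  case empty
  then show ?case by auto
next
  case (insert m F)
  then obtain S' where S': "S' \<subseteq> S" "finite S'" "F \<subseteq> generated S'"
    by auto
  obtain S'' where S'': "S'' \<subseteq> S" "finite S''" "m \<in> generated S''"
    using finitary [of m S] insert.prems by blast
  have "insert m F \<subseteq> generated (S' \<union> S'')"
    using S' S'' hull_mono [of S' "S' \<union> S''"] hull_mono [of S'' "S' \<union> S''"] by blast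
  with S' S'' show ?case
    by (intro exI [of _ "S' \<union> S''"]) auto
qed

section \<open>Compactness of the basic open sets\<close>

lemma compact_space_missing:
  assumes "finite \<A>" "\<And>F. F \<in> \<A> \<Longrightarrow> finite F"
  shows "compact_space (lower_topology (missing \<F> \<A>))"
proof (rule Alexander_subbase_alt)
  let ?S = "{- {N. F \<subseteq> N} | F :: 'a set. finite F}"
  show "missing \<F> \<A> \<subseteq> \<Union>(insert UNIV ?S)"
    by simp
  show "topology (arbitrary union_of
          (finite intersection_of (\<lambda>U. U \<in> insert UNIV ?S) relative_to missing \<F> \<A>))
        = lower_topology (missing \<F> \<A>)"
    by (simp only: finite_intersection_of_insert_UNIV lower_topology_def)
  fix C
  assume C: "C \<subseteq> insert UNIV ?S" "missing \<F> \<A> \<subseteq> \<Union>C"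
  show "\<exists>C'. finite C' \<and> C' \<subseteq> C \<and> missing \<F> \<A> \<subseteq> \<Union>C'"
  proof (cases "UNIV \<in> C")
    case True
    then show ?thesis
      by (intro exI [of _ "{UNIV}"]) auto
  next
    case False
    then have "C \<subseteq> (\<lambda>F. - {N. F \<subseteq> N}) ` {F. finite F}"
      using C by blast
    then obtain \<D> where \<D>: "C = (\<lambda>F. - {N. F \<subseteq> N}) ` \<D>"
      by (auto simp: subset_image_iff)
    \<comment> \<open>This member contains every \<open>F \<in> \<D>\<close>, so it avoids every set
      of the cover.\<close>
    have "generated (\<Union>\<D>) \<notin> \<Union>C"
      using hull_subset [of "\<Union>\<D>"] by (auto simp: \<D>)
    then have "generated (\<Union>\<D>) \<notin> missing \<F> \<A>"
      using C(2) by blast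
    then obtain F where F: "F \<in> \<A>" "F \<subseteq> generated (\<Union>\<D>)"
      using generated_mem [of "\<Union>\<D>"] unfolding missing_def by blast
    then obtain S where S: "S \<subseteq> \<Union>\<D>" "finite S" "F \<subseteq> generated S"
      using finite_subset_generated assms(2) by meson
    then obtain \<E> where \<E>: "finite \<E>" "\<E> \<subseteq> \<D>" "S \<subseteq> \<Union>\<E>"
      using finite_subset_Union [of S \<D>] by metis
    \<comment> \<open>A point outside all these sets would contain \<open>S\<close>, hence
      \<open>generated S\<close>, hence \<open>F\<close>, which points of
      \<open>missing \<F> \<A>\<close> do not.\<close>
    let ?C = "(\<lambda>F. - {N. F \<subseteq> N}) ` \<E>"
    have "N \<in> \<Union>?C" if "N \<in> missing \<F> \<A>" for N
    proof (rule ccontr)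
      assume "N \<notin> \<Union>?C"
      then have "S \<subseteq> N"
        using \<E>(3) by blast
      then have "F \<subseteq> N"
        using that S(3) hull_minimal [of S N "\<lambda>N. N \<in> \<F>"] by (auto simp: missing_def)
      with that F(1) show False
        by (auto simp: missing_def)
    qed
    with \<E> show ?thesis
      by (intro exI [of _ ?C]) (auto simp: \<D>)
  qed
qed

lemma basic_lower_open_compactin:
  "basic_lower_open \<F> U \<Longrightarrow> compactin (lower_topology \<F>) U"
  unfolding basic_lower_open_def compactin_lower_topology
  using compact_space_missing by (auto simp: missing_def)

lemma basic_lower_open_openin:
  "basic_lower_open \<F> U \<Longrightarrow> openin (lower_topology \<F>) U"
  by (simp add: openin_lower_topology arbitrary_union_of_inc)

text \<open>Compact open sets are finite unions of basic ones, and pairwise intersections of basic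
  sets are basic, hence compact.\<close>

lemma compactin_Int_compact_open:
  assumes "openin (lower_topology \<F>) U" "compactin (lower_topology \<F>) U"
    and "openin (lower_topology \<F>) V" "compactin (lower_topology \<F>) V"
  shows "compactin (lower_topology \<F>) (U \<inter> V)"
proof -
  have "(finite union_of basic_lower_open \<F>) U" "(finite union_of basic_lower_open \<F>) V"
    using assms compact_open_finite_union_of_basis openin_lower_topology by metis+
  then obtain \<U> \<V> where \<U>: "finite \<U>" "\<U> \<subseteq> Collect (basic_lower_open \<F>)" "U = \<Union>\<U>"
    and \<V>: "finite \<V>" "\<V> \<subseteq> Collect (basic_lower_open \<F>)" "V = \<Union>\<V>"
    by (auto simp: union_of_def)
  have "U \<inter> V = \<Union>((\<lambda>(S, T). S \<inter> T) ` (\<U> \<times> \<V>))"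
    using \<U> \<V> by auto
  moreover have "compactin (lower_topology \<F>) (\<Union>((\<lambda>(S, T). S \<inter> T) ` (\<U> \<times> \<V>)))"
    using \<U> \<V> by (intro compactin_Union) (auto intro!: basic_lower_open_compactin basic_lower_open_Int)
  ultimately show ?thesis
    by simp
qed

section \<open>Generic points and spectrality\<close>

text \<open>Otherwise a basic neighbourhood of \<open>\<Inter>Z\<close> misses \<open>Z\<close>, so
  finitely many closed sets \<open>{N \<in> \<F>. F \<subseteq> N}\<close> cover \<open>Z\<close>.
  By irreducibility one of them contains \<open>Z\<close>; its \<open>F\<close> then lies in
  \<open>\<Inter>Z\<close>, a contradiction.\<close>

lemma irreducible_closed_Inter_mem:
  assumes "closedin (lower_topology \<F>) Z" "irreducible_in (lower_topology \<F>) Z"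
  shows "\<Inter>Z \<in> Z"
proof (rule ccontr)
  assume "\<Inter>Z \<notin> Z"
  have "Z \<subseteq> \<F>"
    using assms(1) closedin_subset by fastforce
  then have "\<Inter>Z \<in> \<F> - Z"
    using Inter_closed \<open>\<Inter>Z \<notin> Z\<close> by blast
  moreover have "openin (lower_topology \<F>) (\<F> - Z)"
    using assms(1) by (simp add: closedin_def)
  ultimately obtain \<A> where \<A>: "finite \<A>" "\<forall>F\<in>\<A>. finite F"
    "\<Inter>Z \<in> missing \<F> \<A>" "missing \<F> \<A> \<subseteq> \<F> - Z"
    using openin_lower_topologyE by metis
  let ?V = "(\<lambda>F. {N \<in> \<F>. F \<subseteq> N}) ` \<A>"
  have "Z \<subseteq> \<Union>?V"
    using \<A>(4) \<open>Z \<subseteq> \<F>\<close> unfolding missing_def by blast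
  then have "\<exists>A\<in>?V. Z \<subseteq> A"
    using \<A> by (intro irreducible_in_finite_Union [OF assms(2)])
      (auto intro: closedin_lower_topology_above)
  then obtain F where "F \<in> \<A>" "F \<subseteq> \<Inter>Z"
    by blast
  with \<A>(3) show False
    by (auto simp: missing_def)
qed

lemma ex1_generic_point:
  assumes "closedin (lower_topology \<F>) Z" "irreducible_in (lower_topology \<F>) Z"
  shows "\<exists>!N. N \<in> \<F> \<and> lower_topology \<F> closure_of {N} = Z"
proof
  have Z: "\<Inter>Z \<in> Z" "Z \<subseteq> \<F>"
    using irreducible_closed_Inter_mem [OF assms] closedin_subset [OF assms(1)] by simp_all
  then have "lower_topology \<F> closure_of {\<Inter>Z} = {N \<in> \<F>. \<Inter>Z \<subseteq> N}"
    by (intro lower_topology_closure_of_singleton) auto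
  moreover have "lower_topology \<F> closure_of {\<Inter>Z} \<subseteq> Z"
    using Z assms(1) by (intro closure_of_minimal) auto
  moreover have "Z \<subseteq> {N \<in> \<F>. \<Inter>Z \<subseteq> N}"
    using Z by blast
  ultimately show "\<Inter>Z \<in> \<F> \<and> lower_topology \<F> closure_of {\<Inter>Z} = Z"
    using Z by blast
next
  fix N
  assume "N \<in> \<F> \<and> lower_topology \<F> closure_of {N} = Z"
  then show "N = \<Inter>Z"
    \<comment> \<open>\<open>N\<close> is the least member of its own closure, which is
      \<open>Z\<close>.\<close>
    using lower_topology_closure_of_singleton [of N \<F>] by auto
qed

theorem spectral_space_lower_topology: "spectral_space (lower_topology \<F>)"
proof -
  have "compact_space (lower_topology \<F>)"
    using compact_space_missing [of "{}"] by (simp add: missing_def)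
  moreover have "openin (lower_topology \<F>)
      = arbitrary union_of (\<lambda>U. openin (lower_topology \<F>) U \<and> compactin (lower_topology \<F>) U)"
  proof (intro ext iffI)
    fix U
    assume "openin (lower_topology \<F>) U"
    then have "(arbitrary union_of basic_lower_open \<F>) U"
      by (simp add: openin_lower_topology)
    then show "(arbitrary union_of
        (\<lambda>U. openin (lower_topology \<F>) U \<and> compactin (lower_topology \<F>) U)) U"
      by (rule union_of_mono) (simp add: basic_lower_open_openin basic_lower_open_compactin)
  next
    fix U
    assume "(arbitrary union_of
        (\<lambda>U. openin (lower_topology \<F>) U \<and> compactin (lower_topology \<F>) U)) U"
    then show "openin (lower_topology \<F>) U"
      by (auto simp: union_of_def)
  qed
  ultimately show ?thesis
    unfolding spectral_space_def
    using compactin_Int_compact_open ex1_generic_point by simp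
qed

end


section \<open>Closure operators of finite type\<close>

lemma Sub_Inter: "\<G> \<subseteq> Sub act \<Longrightarrow> \<Inter>\<G> \<in> Sub act"
  unfolding Sub_def by blast

lemma Sub_hull_mem: "(\<lambda>N. N \<in> Sub act) hull S \<in> Sub act"
  by (rule hull_in) (auto intro: Sub_Inter)

text \<open>The operations are finitary: the elements generated by finite subsets of
  \<open>S\<close> already form a submodule containing \<open>S\<close>, so they exhaust the
  hull.\<close>

lemma algebraic_closure_system_Sub: "algebraic_closure_system (Sub act)"
proof
  fix \<G>
  assume "\<G> \<subseteq> Sub act"
  then show "\<Inter>\<G> \<in> Sub act"
    by (rule Sub_Inter)
next
  fix m S
  let ?gen = "\<lambda>S. (\<lambda>N. N \<in> Sub act) hull S"
  let ?N = "{m. \<exists>S'\<subseteq>S. finite S' \<and> m \<in> ?gen S'}"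
  note gen = Sub_hull_mem [of act]
  have "S \<subseteq> ?N"
  proof
    fix s
    assume "s \<in> S"
    then show "s \<in> ?N"
      by (auto intro!: exI [of _ "{s}"] hull_inc)
  qed
  moreover have "?N \<in> Sub act"
  proof -
    have "bot \<in> ?N"
      using gen [of "{}"] by (auto simp: Sub_def)
    moreover have "sup m n \<in> ?N" if "m \<in> ?N" "n \<in> ?N" for m n
    proof -
      obtain A B where A: "A \<subseteq> S" "finite A" "m \<in> ?gen A" and B: "B \<subseteq> S" "finite B" "n \<in> ?gen B"
        using \<open>m \<in> ?N\<close> \<open>n \<in> ?N\<close> by blast
      then have "m \<in> ?gen (A \<union> B)" "n \<in> ?gen (A \<union> B)"
        using hull_mono [of A "A \<union> B"] hull_mono [of B "A \<union> B"] by blast+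
      then have "sup m n \<in> ?gen (A \<union> B)"
        using gen [of "A \<union> B"] by (simp add: Sub_def)
      with A B show ?thesis
        by (auto intro!: exI [of _ "A \<union> B"])
    qed
    moreover have "act x m \<in> ?N" if "m \<in> ?N" for x m
    proof -
      obtain A where A: "A \<subseteq> S" "finite A" "m \<in> ?gen A"
        using \<open>m \<in> ?N\<close> by blast
      then have "act x m \<in> ?gen A"
        using gen [of A] by (simp add: Sub_def)
      with A show ?thesis
        by blast
    qed
    ultimately show ?thesis
      by (simp add: Sub_def)
  qed
  ultimately have "?gen S \<subseteq> ?N"
    by (rule hull_minimal)
  moreover assume "m \<in> ?gen S"
  ultimately show "\<exists>S'\<subseteq>S. finite S' \<and> m \<in> ?gen S'"
    by blast
qed

section \<open>Submodules fixed by the closure operator\<close>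

lemma closure_operatorD:
  assumes "closure_operator act c" "N \<in> Sub act"
  shows "c N \<in> Sub act" "N \<subseteq> c N" "c (c N) = c N"
  using assms by (simp_all add: closure_operator_def)

lemma closure_operator_mono:
  "closure_operator act c \<Longrightarrow> N \<in> Sub act \<Longrightarrow> N' \<in> Sub act \<Longrightarrow> N \<subseteq> N' \<Longrightarrow> c N \<subseteq> c N'"
  by (simp add: closure_operator_def)

text \<open>By monotonicity \<open>c (\<Inter>\<G>)\<close> lies below \<open>c N = N\<close> for
  every \<open>N \<in> \<G>\<close>; extensivity gives the other inclusion.\<close>

lemma closure_operator_fixed_Inter:
  assumes "closure_operator act c" "\<G> \<subseteq> Sub_fixed act c"
  shows "\<Inter>\<G> \<in> Sub_fixed act c"
proof -
  have Sub: "\<Inter>\<G> \<in> Sub act"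
    using assms(2) by (intro Sub_Inter) (auto simp: Sub_fixed_def)
  have "c (\<Inter>\<G>) \<subseteq> N" if "N \<in> \<G>" for N
  proof -
    have "N \<in> Sub act" "c N = N"
      using that assms(2) by (auto simp: Sub_fixed_def)
    moreover have "c (\<Inter>\<G>) \<subseteq> c N"
      using assms(1) Sub \<open>N \<in> Sub act\<close> Inter_lower [OF that] by (rule closure_operator_mono)
    ultimately show ?thesis
      by simp
  qed
  moreover have "\<Inter>\<G> \<subseteq> c (\<Inter>\<G>)"
    using assms(1) Sub by (rule closure_operatorD)
  ultimately show ?thesis
    using Sub by (auto simp: Sub_fixed_def)
qed

text \<open>A fixed submodule above \<open>S\<close> contains the submodule generated by
  \<open>S\<close>, hence also its closure. This turns finite type into a statement about
  hulls.\<close>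

lemma closure_operator_hull:
  assumes "closure_operator act c"
  shows "(\<lambda>N. N \<in> Sub_fixed act c) hull S = c ((\<lambda>N. N \<in> Sub act) hull S)"
    (is "_ = c ?gen")
proof (rule hull_unique)
  have gen: "?gen \<in> Sub act"
    by (rule Sub_hull_mem)
  show "S \<subseteq> c ?gen"
    using hull_subset closure_operatorD(2) [OF assms gen] by (rule order_trans)
  show "c ?gen \<in> Sub_fixed act c"
    using closure_operatorD [OF assms gen] by (simp add: Sub_fixed_def)
  fix N
  assume "S \<subseteq> N" "N \<in> Sub_fixed act c"
  then have N: "N \<in> Sub act" "c N = N" "?gen \<subseteq> N"
    using hull_minimal [of S N "\<lambda>N. N \<in> Sub act"] by (simp_all add: Sub_fixed_def)
  then show "c ?gen \<subseteq> N"
    using closure_operator_mono [OF assms gen N(1,3)] by simp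
qed

lemma algebraic_closure_system_Sub_fixed:
  assumes "closure_operator act c" "finite_type act c"
  shows "algebraic_closure_system (Sub_fixed act c)"
proof
  fix \<G>
  assume "\<G> \<subseteq> Sub_fixed act c"
  with assms(1) show "\<Inter>\<G> \<in> Sub_fixed act c"
    by (rule closure_operator_fixed_Inter)
next
  fix m S
  let ?gen = "\<lambda>S. (\<lambda>N. N \<in> Sub act) hull S"
  assume "m \<in> (\<lambda>N. N \<in> Sub_fixed act c) hull S"
  then have "m \<in> c (?gen S)"
    by (simp add: closure_operator_hull [OF assms(1)])
  \<comment> \<open>Finite type replaces \<open>?gen S\<close> by a finitely generated
    \<open>N\<close>. Its generators \<open>F\<close> need only a finite
    \<open>S' \<subseteq> S\<close>, so \<open>N \<subseteq> ?gen S'\<close>, and monotonicity of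
    \<open>c\<close> places \<open>m\<close> in \<open>c (?gen S')\<close>.\<close>
  then obtain N where N: "N \<in> fg act (?gen S)" "m \<in> c N"
    using assms(2) Sub_hull_mem [of act S] by (auto simp: finite_type_def)
  then obtain F where F: "finite F" "F \<subseteq> ?gen S" "\<And>N'. N' \<in> Sub act \<Longrightarrow> F \<subseteq> N' \<Longrightarrow> N \<subseteq> N'"
    and "N \<in> Sub act"
    by (auto simp: fg_def finitely_generated_def)
  obtain S' where S': "S' \<subseteq> S" "finite S'" "F \<subseteq> ?gen S'"
    using algebraic_closure_system.finite_subset_generated [OF algebraic_closure_system_Sub F(1,2)]
    by blast
  have "c N \<subseteq> c (?gen S')"
    using assms(1) \<open>N \<in> Sub act\<close> Sub_hull_mem F(3) [OF Sub_hull_mem S'(3)]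
    by (rule closure_operator_mono)
  with N(2) S' show "\<exists>S'\<subseteq>S. finite S' \<and> m \<in> (\<lambda>N. N \<in> Sub_fixed act c) hull S'"
    by (auto simp: closure_operator_hull [OF assms(1)])
qed

section \<open>Comparison of the topologies and conclusion\<close>

text \<open>\<open>D_set act F\<close> and the full complement of
  \<open>{N. F \<subseteq> N}\<close> have the same trace on \<open>Sub act\<close>, and only traces
  matter.\<close>

lemma Sub_topology_eq_lower_topology: "Sub_topology act = lower_topology (Sub act)"
proof -
  have D: "D_set act F = Sub act \<inter> - {N. F \<subseteq> N}" for F
    by (auto simp: D_set_def V_set_def)
  have "((\<lambda>U. \<exists>F. finite F \<and> U = D_set act F) relative_to Sub act) T
      \<longleftrightarrow> (\<exists>F. finite F \<and> T = D_set act F)" for T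
    unfolding relative_to_def D by blast
  moreover have "((\<lambda>U. U \<in> {- {N. F \<subseteq> N} | F. finite F}) relative_to Sub act) T
      \<longleftrightarrow> (\<exists>F. finite F \<and> T = D_set act F)" for T
    unfolding relative_to_def D by blast
  ultimately have "(\<lambda>U. \<exists>F. finite F \<and> U = D_set act F) relative_to Sub act
      = (\<lambda>U. U \<in> {- {N. F \<subseteq> N} | F. finite F}) relative_to Sub act"
    by (simp only: fun_eq_iff simp_thms)
  from finite_intersection_of_relative_to_cong [OF this] show ?thesis
    unfolding Sub_topology_def lower_topology_def by (simp only:)
qed

lemma D_set_Int_Sub_fixed: "D_set act F \<inter> Sub_fixed act c = missing (Sub_fixed act c) {F}"
  by (auto simp: D_set_def V_set_def Sub_fixed_def missing_def)

lemma subbasis_of_S_fixed: "subbasis_of (lower_topology (Sub_fixed act c)) (S_fixed act c)"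
proof -
  let ?F = "Sub_fixed act c"
  have S: "S_fixed act c = {?F \<inter> - {N. F \<subseteq> N} | F. finite F}"
    by (auto simp: S_fixed_def D_set_Int_Sub_fixed missing_def)
  have "(\<lambda>U. U \<in> S_fixed act c) relative_to ?F
      = (\<lambda>U. U \<in> {- {N. F \<subseteq> N} | F. finite F}) relative_to ?F"
    unfolding S relative_to_def by (intro ext) blast
  from finite_intersection_of_relative_to_cong [OF this] show ?thesis
    by (simp only: subbasis_of_def topspace_lower_topology openin_lower_topology_subbase)
qed

theorem proposition11p4:
  fixes act :: "'h::heyting_algebra \<Rightarrow> 'm::bounded_semilattice_sup_bot \<Rightarrow> 'm"
    and c :: "'m set \<Rightarrow> 'm set"
  assumes "heyting_module act"
    and "closure_operator act c"
    and "finite_type act c"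
  defines "X \<equiv> subtopology (Sub_topology act) (Sub_fixed act c)"
  shows "spectral_space X \<and>
         subbasis_of X (S_fixed act c) \<and>
         (\<forall>U\<in>S_fixed act c. openin X U \<and> compactin X U)"
proof -
  interpret algebraic_closure_system "Sub_fixed act c"
    using assms(2,3) by (rule algebraic_closure_system_Sub_fixed)
  have "Sub act \<inter> Sub_fixed act c = Sub_fixed act c"
    by (auto simp: Sub_fixed_def)
  \<comment> \<open>The subspace topology is again a lower topology, now on an algebraic closure
    system, so the general results apply.\<close>
  then have X: "X = lower_topology (Sub_fixed act c)"
    by (simp add: X_def Sub_topology_eq_lower_topology subtopology_lower_topology)
  have "basic_lower_open (Sub_fixed act c) U" if "U \<in> S_fixed act c" for U
    using that by (auto simp: S_fixed_def D_set_Int_Sub_fixed basic_lower_open_def)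
  then show ?thesis
    using spectral_space_lower_topology subbasis_of_S_fixed
      basic_lower_open_openin basic_lower_open_compactin
    unfolding X by blast
qed

end
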